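(* Let $(X,d)$ be a complete nearly uniformly convex metric space and let $C\subset X$ be a non-empty closed convex subset. Then for every $x\in X$ the set $$P_C(x)=\{c\in C : d(x,c)=\inf_{c'\in C}d(x,c')\}$$ is non-empty and compact.
   Context: A midpoint of $x,y\in X$ is a point $m$ with $d(x,m)=d(y,m)=\frac12 d(x,y)$. $(X,d)$ admits midpoints if every pair of points has a midpoint; a complete metric space admitting midpoints is geodesic. A complete metric space admitting midpoints is $\infty$-convex if $d(m,z)\le\max\{d(x,z),d(y,z)\}$ for all $x,y,z\in X$ and every midpoint $m$ of $x$ and $y$. A subset $C\subset X$ is convex if for all $x,y\in C$ every geodesic connecting $x$ and $y$ is contained in $C$. For $A\subset X$ put $G_0=A$ and let $G_n$ be the union of all geodesics connecting two points of $G_{n-1}$; the convex hull is $\operatorname{conv}A=\bigcup_{n}G_n$, and $\overline{\operatorname{conv}A}$ is its closure. A family $(x_i)_{i\in I}$ is $\epsilon$-separated if $d(x_i,x_j)\ge\epsilon$ for all $i\neq j$. An $\infty$-convex space is nearly uniformly convex if for every $R>0$ and $\epsilon>0$ there is $\rho=\rho(\epsilon,R)>0$ such that for every $y\in X$, every $r\le R$ and every infinite $\epsilon$-separated family $(x_i)_{i\in I}$ with $d(x_i,y)\le r$ for all $i$, one has $B_{(1-\rho)r}(y)\cap\overline{\operatorname{conv}(x_i)_{i\in I}}\neq\varnothing$, where $B_s(y)$ denotes the closed ball of radius $s$ around $y$. *)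

theory Defs
  imports "HOL-Analysis.Analysis"
begin

definition is_midpoint :: "'a::metric_space \<Rightarrow> 'a \<Rightarrow> 'a \<Rightarrow> bool" where
  "is_midpoint m x y \<longleftrightarrow> dist x m = dist x y / 2 \<and> dist y m = dist x y / 2"

text \<open>
  Properties of the whole space are predicates on the type, applied as in
  \<open>infty_convex TYPE('a)\<close>.
\<close>

definition admits_midpoints :: "'a::metric_space itself \<Rightarrow> bool" where
  "admits_midpoints _ \<longleftrightarrow> (\<forall>x y::'a. \<exists>m. is_midpoint m x y)"

definition infty_convex :: "'a::metric_space itself \<Rightarrow> bool" where
  "infty_convex _ \<longleftrightarrow>
     complete (UNIV :: 'a set) \<and> admits_midpoints TYPE('a) \<and>
     (\<forall>x y z m :: 'a. is_midpoint m x y \<longrightarrow> dist m z \<le> max (dist x z) (dist y z))"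

text \<open>
  Geodesics are minimal and parametrised on the unit interval with constant speed. Where a
  geodesic is treated as a subset of the space, its image \<open>\<gamma> ` {0..1}\<close> is meant. The values
  of \<open>\<gamma>\<close> outside the unit interval play no role.
\<close>

definition geodesic_from_to :: "(real \<Rightarrow> 'a::metric_space) \<Rightarrow> 'a \<Rightarrow> 'a \<Rightarrow> bool" where
  "geodesic_from_to \<gamma> x y \<longleftrightarrow>
     \<gamma> 0 = x \<and> \<gamma> 1 = y \<and>
     (\<forall>s\<in>{0..1}. \<forall>t\<in>{0..1}. dist (\<gamma> s) (\<gamma> t) = \<bar>s - t\<bar> * dist x y)"

definition geodesically_convex :: "'a::metric_space set \<Rightarrow> bool" where
  "geodesically_convex C \<longleftrightarrow>
     (\<forall>x\<in>C. \<forall>y\<in>C. \<forall>\<gamma>. geodesic_from_to \<gamma> x y \<longrightarrow> \<gamma> ` {0..1} \<subseteq> C)"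

primrec geodesic_hull_step :: "'a::metric_space set \<Rightarrow> nat \<Rightarrow> 'a set" where
  "geodesic_hull_step A 0 = A"
| "geodesic_hull_step A (Suc n) =
     \<Union>{\<gamma> ` {0..1} | \<gamma> x y.
         x \<in> geodesic_hull_step A n \<and> y \<in> geodesic_hull_step A n \<and> geodesic_from_to \<gamma> x y}"

definition geodesic_hull :: "'a::metric_space set \<Rightarrow> 'a set" where
  "geodesic_hull A = (\<Union>n. geodesic_hull_step A n)"

definition separated_family :: "real \<Rightarrow> 'i set \<Rightarrow> ('i \<Rightarrow> 'a::metric_space) \<Rightarrow> bool" where
  "separated_family \<epsilon> I x \<longleftrightarrow> (\<forall>i\<in>I. \<forall>j\<in>I. i \<noteq> j \<longrightarrow> dist (x i) (x j) \<ge> \<epsilon>)"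

text \<open>
  A definition cannot quantify over index types, so the families below are indexed by sets
  \<open>I :: 'a set\<close>. This loses no generality: for \<open>\<epsilon> > 0\<close> an \<open>\<epsilon>\<close>-separated family is injective,
  hence can be reindexed by its own range.
\<close>

definition nearly_uniformly_convex :: "'a::metric_space itself \<Rightarrow> bool" where
  "nearly_uniformly_convex _ \<longleftrightarrow>
     infty_convex TYPE('a) \<and>
     (\<forall>R>0. \<forall>\<epsilon>>0. \<exists>\<rho>>0. \<forall>(y::'a) r (I::'a set) (x::'a \<Rightarrow> 'a).
        r \<le> R \<and> infinite I \<and> separated_family \<epsilon> I x \<and> (\<forall>i\<in>I. dist (x i) y \<le> r) \<longrightarrow>
        cball y ((1 - \<rho>) * r) \<inter> closure (geodesic_hull (x ` I)) \<noteq> {})"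

definition metric_projection :: "'a::metric_space set \<Rightarrow> 'a \<Rightarrow> 'a set" where
  "metric_projection C x = {c \<in> C. dist x c = (INF c'\<in>C. dist x c')}"

end

theory Submission
  imports Defs
begin

text \<open>
  Near the infimum distance \<open>D\<close> from \<open>x\<close> to \<open>C\<close>, the set \<open>C\<close> contains no infinite
  \<open>\<epsilon>\<close>-separated family: for \<open>D > 0\<close> and \<open>\<delta>\<close> small, near uniform convexity would turn such a
  family within distance \<open>D + \<delta>\<close> of \<open>x\<close> into a point of \<open>C\<close> (which contains the closed hull of
  the family) at distance at most \<open>(1 - \<rho>) (D + \<delta>) < D\<close>. Hence every minimising sequence is
  totally bounded and so has a subsequence converging to a nearest point. Applied to an arbitrary
  minimising sequence this yields existence; applied to sequences of nearest points it yields
  compactness.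
\<close>

text \<open>Greedy choice: the finitely many points chosen so far never cover \<open>T\<close> by
  \<open>e\<close>-balls, so some point of \<open>T\<close> is at distance at least \<open>e\<close>
  from all of them. Taking \<open>S\<close> as its own index set, with \<open>id\<close> as the
  family, fits the form of families in \<open>nearly_uniformly_convex\<close>.\<close>

lemma infinite_separated_subset:
  fixes T :: "'a::metric_space set"
  assumes "e > 0" and no_net: "\<And>F. finite F \<Longrightarrow> F \<subseteq> T \<Longrightarrow> \<not> T \<subseteq> (\<Union>p\<in>F. ball p e)"
  obtains S where "S \<subseteq> T" "infinite S" "separated_family e S id"
proof -
  \<comment> \<open>\<open>Q f n p\<close> looks at \<open>f\<close> only below \<open>n\<close>, as
    well-founded dependent choice requires.\<close>
  define Q where "Q f n p \<longleftrightarrow> p \<in> T \<and> (\<forall>m<n. dist (f m) p \<ge> e)" for f :: "nat \<Rightarrow> 'a" and n p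
  have "\<exists>f. \<forall>n::nat. Q f n (f n)"
  proof (rule dependent_wellorder_choice)
    fix n and f :: "nat \<Rightarrow> 'a"
    assume "\<And>m. m < n \<Longrightarrow> Q f m (f m)"
    then have "f ` {..<n} \<subseteq> T"
      by (auto simp: Q_def)
    then have "\<not> T \<subseteq> (\<Union>p\<in>f ` {..<n}. ball p e)"
      by (intro no_net) auto
    then show "\<exists>p. Q f n p"
      by (auto simp: Q_def subset_iff not_less)
  qed (simp add: Q_def)
  then obtain f where "\<And>n. Q f n (f n)" by auto
  then have f: "f n \<in> T" "m < n \<Longrightarrow> dist (f m) (f n) \<ge> e" for m n
    unfolding Q_def by blast+
  have sep: "dist (f m) (f n) \<ge> e" if "m \<noteq> n" for m n
    using f(2)[of m n] f(2)[of n m] that by (cases "m < n") (auto simp: dist_commute)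
  then have "inj f"
    using \<open>e > 0\<close> by (intro injI) (metis dist_self not_le)
  show thesis
  proof
    show "range f \<subseteq> T" using f(1) by auto
    show "infinite (range f)" using \<open>inj f\<close> by (simp add: range_inj_infinite)
    show "separated_family e (range f) id"
      by (auto simp: separated_family_def intro!: sep)
  qed
qed

lemma compact_closure_if_finite_nets:
  fixes S :: "'a::metric_space set"
  assumes "complete (UNIV :: 'a set)"
    and net: "\<And>e. e > 0 \<Longrightarrow> \<exists>F. finite F \<and> S \<subseteq> (\<Union>p\<in>F. ball p e)"
  shows "compact (closure S)"
  unfolding compact_eq_totally_bounded
proof (intro conjI allI impI)
  show "complete (closure S)"
    using complete_closed_subset[OF closed_closure subset_UNIV assms(1)] .
  fix e :: real assume "e > 0"
  then obtain F where F: "finite F" "S \<subseteq> (\<Union>p\<in>F. ball p (e/2))"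
    using net[of "e/2"] by auto
  \<comment> \<open>A finite union of closed balls is closed and so absorbs the closure; halving the
    radius leaves room to return to open balls of radius \<open>e\<close>.\<close>
  have "S \<subseteq> (\<Union>p\<in>F. cball p (e/2))"
    using F(2) UN_mono[OF subset_refl ball_subset_cball] by (rule subset_trans)
  moreover have "closed (\<Union>p\<in>F. cball p (e/2))"
    using F(1) closed_cball by (intro closed_UN ballI)
  ultimately have "closure S \<subseteq> (\<Union>p\<in>F. cball p (e/2))"
    by (rule closure_minimal)
  also have "\<dots> \<subseteq> (\<Union>p\<in>F. ball p e)"
    using \<open>e > 0\<close> by (intro UN_mono) auto
  finally show "\<exists>k. finite k \<and> closure S \<subseteq> (\<Union>p\<in>k. ball p e)"
    using F(1) by auto
qed

text \<open>Convexity absorbs each hull step by induction, and closedness absorbs the limit points.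
  This places the point supplied by near uniform convexity in \<open>C\<close>.\<close>

lemma closure_geodesic_hull_subset:
  assumes "geodesically_convex C" "closed C" "A \<subseteq> C"
  shows "closure (geodesic_hull A) \<subseteq> C"
proof -
  have "geodesic_hull_step A n \<subseteq> C" for n
  proof (induction n)
    case 0
    show ?case using assms(3) by simp
  next
    case (Suc n)
    then show ?case
      using assms(1) unfolding geodesically_convex_def geodesic_hull_step.simps by blast
  qed
  then show ?thesis
    unfolding geodesic_hull_def using assms(2) by (intro closure_minimal) auto
qed

lemma metric_projection_eq_infdist:
  assumes "C \<noteq> {}"
  shows "metric_projection C x = {c \<in> C. dist x c = infdist x C}"
  using assms by (simp add: metric_projection_def infdist_def)

lemma finite_net_near_infdist:
  fixes C :: "'a::metric_space set"
  assumes nuc: "nearly_uniformly_convex TYPE('a)"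
    and C: "closed C" "geodesically_convex C" and "e > 0"
  obtains d F where "d > 0" "finite F" "C \<inter> cball x (infdist x C + d) \<subseteq> (\<Union>p\<in>F. ball p e)"
proof (cases "infdist x C = 0")
  case True
  \<comment> \<open>At infimum distance 0 shrinking the radius contradicts nothing, but a small ball
    around \<open>x\<close> is itself covered by \<open>ball x e\<close>.\<close>
  show thesis
  proof
    show "e/2 > 0" using \<open>e > 0\<close> by simp
    show "finite {x}" by simp
    show "C \<inter> cball x (infdist x C + e/2) \<subseteq> (\<Union>p\<in>{x}. ball p e)"
      using True \<open>e > 0\<close> by auto
  qed
next
  case False
  define D where "D = infdist x C"
  have "D > 0"
    using False infdist_nonneg[of x C] by (simp add: D_def)
  then have "D + 1 > 0" by simp
  \<comment> \<open>The bound \<open>D + 1\<close> is fixed first, since \<rho> depends on it and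
    \<open>d\<close> will depend on \<rho>; then \<open>d \<le> 1\<close> keeps the radius
    \<open>D + d\<close> admissible.\<close>
  obtain \<rho> where "\<rho> > 0"
    and \<rho>: "\<forall>(y::'a) r (I::'a set) (z::'a \<Rightarrow> 'a).
        r \<le> D + 1 \<and> infinite I \<and> separated_family e I z \<and> (\<forall>i\<in>I. dist (z i) y \<le> r) \<longrightarrow>
        cball y ((1 - \<rho>) * r) \<inter> closure (geodesic_hull (z ` I)) \<noteq> {}"
    using nuc[unfolded nearly_uniformly_convex_def, THEN conjunct2, rule_format,
        OF \<open>D + 1 > 0\<close> \<open>e > 0\<close>] by (elim exE conjE) (rule that)
  \<comment> \<open>With \<open>d \<le> \<rho> * D / 2\<close>, the product
    \<open>(1 - \<rho>) * (D + d)\<close> is at most \<open>D - \<rho> * D / 2 - \<rho> * d\<close>,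
    hence below \<open>D\<close>.\<close>
  define d where "d = min 1 (\<rho> * D / 2)"
  have d: "d > 0" "d \<le> 1"
    using \<open>\<rho> > 0\<close> \<open>D > 0\<close> by (auto simp: d_def)
  have small: "(1 - \<rho>) * (D + d) < D"
  proof -
    have "d \<le> \<rho> * D / 2" "\<rho> * D > 0" "\<rho> * d > 0"
      using \<open>\<rho> > 0\<close> \<open>D > 0\<close> d by (auto simp: d_def)
    then show ?thesis by (simp add: algebra_simps)
  qed
  have "\<exists>F. finite F \<and> C \<inter> cball x (D + d) \<subseteq> (\<Union>p\<in>F. ball p e)"
  proof (rule ccontr)
    assume "\<not> ?thesis"
    then obtain S where S: "S \<subseteq> C \<inter> cball x (D + d)" "infinite S" "separated_family e S id"
      using infinite_separated_subset[OF \<open>e > 0\<close>, of "C \<inter> cball x (D + d)"] by metis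
    have "cball x ((1 - \<rho>) * (D + d)) \<inter> closure (geodesic_hull (id ` S)) \<noteq> {}"
      using S d by (intro \<rho>[rule_format]) (auto simp: dist_commute)
    then obtain p where "dist x p \<le> (1 - \<rho>) * (D + d)" "p \<in> closure (geodesic_hull S)"
      by auto
    moreover have "closure (geodesic_hull S) \<subseteq> C"
      using closure_geodesic_hull_subset C S(1) by auto
    ultimately have "D < D"
      using small infdist_le[of p C x] by (auto simp: D_def)
    then show False by simp
  qed
  then show thesis
    using that d by (auto simp: D_def)
qed

lemma minimizing_sequence_subconverges:
  fixes C :: "'a::metric_space set" and f :: "nat \<Rightarrow> 'a"
  assumes "complete (UNIV :: 'a set)" "nearly_uniformly_convex TYPE('a)"
    and C: "C \<noteq> {}" "closed C" "geodesically_convex C"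
    and f: "\<And>n. f n \<in> C" "(\<lambda>n. dist x (f n)) \<longlonglongrightarrow> infdist x C"
  obtains l r where "l \<in> metric_projection C x" "strict_mono (r :: nat \<Rightarrow> nat)" "(f \<circ> r) \<longlonglongrightarrow> l"
proof -
  have "compact (closure (range f))"
  proof (rule compact_closure_if_finite_nets[OF assms(1)])
    fix e :: real assume "e > 0"
    then obtain d F where d: "d > 0" and F: "finite F"
      "C \<inter> cball x (infdist x C + d) \<subseteq> (\<Union>p\<in>F. ball p e)"
      using finite_net_near_infdist[OF assms(2) C(2,3)] by blast
    have "\<forall>\<^sub>F n in sequentially. dist x (f n) < infdist x C + d"
      using f(2) d by (intro order_tendstoD) auto
    then obtain N where N: "\<And>n. n \<ge> N \<Longrightarrow> dist x (f n) < infdist x C + d"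
      by (auto simp: eventually_sequentially)
    \<comment> \<open>From \<open>N\<close> on the sequence stays in the region covered by
      \<open>F\<close>; the finitely many earlier terms serve as their own centres.\<close>
    have "f n \<in> (\<Union>p\<in>F \<union> f ` {..<N}. ball p e)" for n
    proof (cases "n < N")
      case True
      then show ?thesis using \<open>e > 0\<close> by force
    next
      case False
      then have "f n \<in> C \<inter> cball x (infdist x C + d)"
        using f(1) N[of n] by auto
      then show ?thesis using F(2) by blast
    qed
    then show "\<exists>F. finite F \<and> range f \<subseteq> (\<Union>p\<in>F. ball p e)"
      using F(1) by (intro exI[of _ "F \<union> f ` {..<N}"]) blast
  qed
  moreover have "\<forall>n. f n \<in> closure (range f)"
    using closure_subset by fast
  ultimately obtain l r where lr: "strict_mono r" "(f \<circ> r) \<longlonglongrightarrow> l"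
    unfolding compact_def by metis
  have "l \<in> C"
    using closed_sequentially[OF C(2) _ lr(2)] f(1) by simp
  moreover have "dist x l = infdist x C"
  proof (rule LIMSEQ_unique)
    show "(\<lambda>n. dist x ((f \<circ> r) n)) \<longlonglongrightarrow> dist x l"
      using lr(2) by (intro tendsto_intros)
    show "(\<lambda>n. dist x ((f \<circ> r) n)) \<longlonglongrightarrow> infdist x C"
      using LIMSEQ_subseq_LIMSEQ[OF f(2) lr(1)] by (simp add: o_def)
  qed
  ultimately show thesis
    using that lr C(1) by (simp add: metric_projection_eq_infdist)
qed

lemma minimizing_sequence_exists:
  fixes C :: "'a::metric_space set"
  assumes "C \<noteq> {}"
  obtains f :: "nat \<Rightarrow> 'a" where "\<And>n. f n \<in> C" "(\<lambda>n. dist x (f n)) \<longlonglongrightarrow> infdist x C"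
proof -
  \<comment> \<open>\<open>Suc n\<close> keeps the slack positive at \<open>n = 0\<close>, where
    \<open>inverse 0\<close> would be 0.\<close>
  have "\<exists>c\<in>C. dist x c < infdist x C + inverse (real (Suc n))" for n
  proof -
    have "Inf (dist x ` C) < infdist x C + inverse (real (Suc n))"
      using assms by (simp add: infdist_def)
    then show ?thesis
      using cInf_lessD[of "dist x ` C"] assms by blast
  qed
  then obtain f where f: "\<And>n. f n \<in> C" "\<And>n. dist x (f n) < infdist x C + inverse (real (Suc n))"
    by metis
  have "(\<lambda>n. dist x (f n)) \<longlonglongrightarrow> infdist x C"
  proof (rule tendsto_sandwich)
    show "\<forall>\<^sub>F n in sequentially. infdist x C \<le> dist x (f n)"
      using f(1) by (simp add: infdist_le)
    show "\<forall>\<^sub>F n in sequentially. dist x (f n) \<le> infdist x C + inverse (real (Suc n))"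
      using f(2) by (simp add: less_imp_le)
  qed (rule tendsto_const, rule LIMSEQ_inverse_real_of_nat_add)
  then show thesis
    using that f(1) by blast
qed

theorem theorem8:
  fixes C :: "'a::metric_space set"
  assumes "complete (UNIV :: 'a set)"
    and "nearly_uniformly_convex TYPE('a)"
    and "C \<noteq> {}" and "closed C" and "geodesically_convex C"
  shows "\<forall>x. metric_projection C x \<noteq> {} \<and> compact (metric_projection C x)"
proof (intro allI conjI)
  fix x
  obtain f where f: "\<And>n. f n \<in> C" "(\<lambda>n. dist x (f n)) \<longlonglongrightarrow> infdist x C"
    using minimizing_sequence_exists[OF assms(3)] by blast
  show "metric_projection C x \<noteq> {}"
    using minimizing_sequence_subconverges[OF assms f] by blast
  show "compact (metric_projection C x)"
    unfolding compact_def
  proof (intro allI impI)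
    fix g :: "nat \<Rightarrow> 'a" assume "\<forall>n. g n \<in> metric_projection C x"
    \<comment> \<open>The distances from \<open>x\<close> to the terms of \<open>g\<close> are
      constantly the infimum, so \<open>g\<close> is minimising.\<close>
    then have "\<And>n. g n \<in> C" "(\<lambda>n. dist x (g n)) \<longlonglongrightarrow> infdist x C"
      by (simp_all add: metric_projection_eq_infdist[OF assms(3)])
    then show "\<exists>l\<in>metric_projection C x. \<exists>r. strict_mono r \<and> (g \<circ> r) \<longlonglongrightarrow> l"
      using minimizing_sequence_subconverges[OF assms] by metis
  qed
qed

end
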